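(* Let $S\subset\mathbb{H}$ be a topological surface with the flat cone property. Then $S$ has locally the full cone property, i.e. for every $o\in S$ there is an open neighborhood $U\subset\mathbb{H}$ of $o$ such that $S\cap U$ has the full cone property. Quantitatively, for every $\alpha>0$: if $S\subset\mathbb{H}$ is a topological surface with the $\alpha$-flat cone property, then $S$ has locally the $\alpha/4$-full cone property, i.e. for every $o\in S$ there is an open neighborhood $U\subset\mathbb{H}$ of $o$ such that for all $p\in S\cap U$, \[ \mathtt{C}(\alpha/4)\cap p^{-1}(S\cap U)=\emptyset . \]
   Context: The first Heisenberg group $\mathbb{H}$ is $\mathbb{R}^3$ (with its usual topology) with the group operation $(x,y,z)(x',y',z')=\left(x+x',\,y+y',\,z+z'+\frac{xy'-x'y}{2}\right)$; the inverse of $(x,y,z)$ is $(-x,-y,-z)$. For $E\subset\mathbb{H}$ and $p\in\mathbb{H}$, $pE=\{pe:e\in E\}$, and $-E=\{-e : e\in E\}$. For $\lambda>0$ the dilation $\delta_\lambda$ is $\delta_\lambda(x,y,z)=(\lambda x,\lambda y,\lambda^2 z)$. A cone is a set $E\subset\mathbb{H}$ with $\delta_\lambda(E)=E$ for all $\lambda>0$. For $\alpha>0$, the $\alpha$-full cone is $\mathtt{C}(\alpha)=\{(x,y,z): |y|<\alpha|x|,\ |z|<\alpha x^2/2\}$ and the flat cone is $\mathtt{fC}(\alpha)=\{(x,y,0): |y|<\alpha|x|\}$. A set $S\subset\mathbb{H}$ has the full cone property if there is an open cone $C$ with $-C=C$, $C\cap\{z=0\}\neq\emptyset$ and $C\cap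 p^{-1}S=\emptyset$ for all $p\in S$. It has the $\alpha$-full cone property if this holds with $C=\mathtt{C}(\alpha)$, i.e. $\mathtt{C}(\alpha)\cap p^{-1}S=\emptyset$ for all $p\in S$. It has the $\alpha$-flat cone property if $\mathtt{fC}(\alpha)\cap p^{-1}S=\emptyset$ for all $p\in S$; it has the flat cone property if it has the $\alpha$-flat cone property for some $\alpha>0$. A topological surface in $\mathbb{H}$ is a subset which, with the subspace topology, is a two-dimensional topological manifold (without boundary). *)

theory Defs
  imports "HOL-Analysis.Analysis"
begin

text \<open>The first Heisenberg group: the product type carries the usual topology of
  three-dimensional space. Its componentwise group structure from the library is not the
  Heisenberg one.\<close>

type_synonym heis = "real \<times> real \<times> real"

fun heis_mult :: "heis \<Rightarrow> heis \<Rightarrow> heis" where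
  "heis_mult (x, y, z) (x', y', z') = (x + x', y + y', z + z' + (x * y' - x' * y) / 2)"

fun heis_inv :: "heis \<Rightarrow> heis" where
  "heis_inv (x, y, z) = (- x, - y, - z)"

lemma heis_mult_assoc: "heis_mult (heis_mult p q) r = heis_mult p (heis_mult q r)"
  by (cases p; cases q; cases r) (auto simp: field_simps)

lemma heis_inv_left: "heis_mult (heis_inv p) p = (0, 0, 0)"
  by (cases p) auto

lemma heis_zero_left: "heis_mult (0, 0, 0) p = p"
  by (cases p) auto

definition heis_translate :: "heis \<Rightarrow> heis set \<Rightarrow> heis set" where
  "heis_translate p E = heis_mult p ` E"

fun heis_dilation :: "real \<Rightarrow> heis \<Rightarrow> heis" where
  "heis_dilation l (x, y, z) = (l * x, l * y, l\<^sup>2 * z)"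

definition heis_cone :: "heis set \<Rightarrow> bool" where
  "heis_cone E \<longleftrightarrow> (\<forall>l>0. heis_dilation l ` E = E)"

definition full_cone :: "real \<Rightarrow> heis set" where
  "full_cone \<alpha> = {(x, y, z). \<bar>y\<bar> < \<alpha> * \<bar>x\<bar> \<and> \<bar>z\<bar> < \<alpha> * x\<^sup>2 / 2}"

definition flat_cone :: "real \<Rightarrow> heis set" where
  "flat_cone \<alpha> = {(x, y, z). z = 0 \<and> \<bar>y\<bar> < \<alpha> * \<bar>x\<bar>}"

definition avoids_cone :: "heis set \<Rightarrow> heis set \<Rightarrow> bool" where
  "avoids_cone S C \<longleftrightarrow> (\<forall>p\<in>S. C \<inter> heis_translate (heis_inv p) S = {})"

definition full_cone_property :: "heis set \<Rightarrow> bool" where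
  "full_cone_property S \<longleftrightarrow>
     (\<exists>C. open C \<and> heis_cone C \<and> heis_inv ` C = C \<and> C \<inter> {(x, y, z). z = 0} \<noteq> {} \<and>
          avoids_cone S C)"

definition alpha_full_cone_property :: "real \<Rightarrow> heis set \<Rightarrow> bool" where
  "alpha_full_cone_property \<alpha> S \<longleftrightarrow> avoids_cone S (full_cone \<alpha>)"

definition alpha_flat_cone_property :: "real \<Rightarrow> heis set \<Rightarrow> bool" where
  "alpha_flat_cone_property \<alpha> S \<longleftrightarrow> avoids_cone S (flat_cone \<alpha>)"

definition flat_cone_property :: "heis set \<Rightarrow> bool" where
  "flat_cone_property S \<longleftrightarrow> (\<exists>\<alpha>>0. alpha_flat_cone_property \<alpha> S)"

definition has_locally :: "(heis set \<Rightarrow> bool) \<Rightarrow> heis set \<Rightarrow> bool" where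
  "has_locally P S \<longleftrightarrow> (\<forall>q\<in>S. \<exists>U. open U \<and> q \<in> U \<and> P (S \<inter> U))"

definition topological_2_manifold :: "'a topology \<Rightarrow> bool" where
  "topological_2_manifold X \<longleftrightarrow>
     Hausdorff_space X \<and> second_countable X \<and>
     (\<forall>p\<in>topspace X. \<exists>V (W :: (real ^ 2) set).
        openin X V \<and> p \<in> V \<and> open W \<and> subtopology X V homeomorphic_space top_of_set W)"

definition topological_surface :: "heis set \<Rightarrow> bool" where
  "topological_surface S \<longleftrightarrow> topological_2_manifold (top_of_set S)"

end

theory Submission
  imports Defs
begin

text \<open>The \<open>X\<close>-lines \<open>p (t, 0, 0)\<close> meet a set with the flat cone property at most once, so by invariance
  of domain a surface \<open>S\<close> with this property is locally an intrinsic graph over an open planar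
  set and hence has a right and a left side. For \<open>p \<in> S\<close> the right half of the wedge \<open>p fC(\<alpha>)\<close> is
  connected, avoids \<open>S\<close> and contains points of an \<open>X\<close>-line through \<open>p\<close>, so it lies on the right
  of \<open>S\<close>; likewise the left half of the wedge at \<open>q \<in> S\<close> lies on the left. If \<open>p\<^sup>-\<^sup>1 q\<close> lies in
  \<open>C(\<alpha>/4)\<close> with positive first coordinate, these two half wedges meet, which is absurd.\<close>

text \<open>The product of \<open>(x, y, z)\<close> with \<open>(- x, 0, 0)\<close> is
  \<open>(0, y, z + x * y / 2)\<close>, the point where the X-line through \<open>(x, y, z)\<close>
  crosses the plane of vanishing first coordinate. The fibres are exactly the X-lines.\<close>

fun xline_proj :: "heis \<Rightarrow> real \<times> real" where
  "xline_proj (x, y, z) = (y, z + x * y / 2)"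

lemma xline_proj_alt: "xline_proj p = (fst (snd p), snd (snd p) + fst p * fst (snd p) / 2)"
  by (cases p) auto

lemma heis_mult_alt:
  "heis_mult p q = (fst p + fst q, fst (snd p) + fst (snd q),
     snd (snd p) + snd (snd q) + (fst p * fst (snd q) - fst q * fst (snd p)) / 2)"
  by (cases p; cases q) auto

lemma xline_proj_mult_X: "xline_proj (heis_mult p (s, 0, 0)) = xline_proj p"
  by (cases p) (auto simp: field_simps)

lemma heis_inv_inv [simp]: "heis_inv (heis_inv p) = p"
  by (cases p) auto

lemma heis_mult_inv_left: "heis_mult (heis_inv p) (heis_mult p c) = c"
  by (simp add: heis_mult_assoc [symmetric] heis_inv_left heis_zero_left)

lemma heis_mult_inv_right: "heis_mult p (heis_mult (heis_inv p) c) = c"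
  using heis_mult_inv_left [of "heis_inv p" c] by simp

lemma heis_inv_mult: "heis_inv (heis_mult p q) = heis_mult (heis_inv q) (heis_inv p)"
  by (cases p; cases q) (auto simp: field_simps)

lemma avoids_cone_iff:
  "avoids_cone S C \<longleftrightarrow> (\<forall>p\<in>S. \<forall>q\<in>S. heis_mult (heis_inv p) q \<notin> C)"
  unfolding avoids_cone_def heis_translate_def by blast

lemma avoids_coneD:
  assumes "avoids_cone S C" "p \<in> S" "c \<in> C"
  shows "heis_mult p c \<notin> S"
  using assms by (metis avoids_cone_iff heis_mult_inv_left)

text \<open>Distinct points of one X-line differ by a group element \<open>(s, 0, 0)\<close> with
  nonzero \<open>s\<close>, and every flat cone with positive \<open>\<alpha>\<close> contains
  it.\<close>

lemma avoids_flat_cone_inj_on: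
  assumes "avoids_cone S (flat_cone \<alpha>)" "\<alpha> > 0"
  shows "inj_on xline_proj S"
proof (rule inj_onI, rule ccontr)
  fix p q assume pq: "p \<in> S" "q \<in> S" "xline_proj p = xline_proj q" "p \<noteq> q"
  obtain x y z x' y' z' where p: "p = (x, y, z)" and q: "q = (x', y', z')"
    by (metis prod_cases3)
  have "heis_mult (heis_inv p) q = (x' - x, 0, 0)" "x' \<noteq> x"
    using pq by (auto simp: p q field_simps)
  then have "heis_mult (heis_inv p) q \<in> flat_cone \<alpha>"
    using assms(2) by (simp add: flat_cone_def)
  with assms(1) pq show False by (auto simp: avoids_cone_iff)
qed

text \<open>A local parametrisation \<open>h\<close> of \<open>S\<close> followed by
  \<open>f\<close> is a continuous injection of a planar open set, so by invariance of domain its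
  image is open and its inverse continuous; the section is this inverse followed by
  \<open>h\<close>. For \<open>f = xline_proj\<close> it exhibits \<open>S\<close> near
  \<open>a\<close> as an intrinsic graph.\<close>

lemma topological_2_manifold_local_section:
  fixes S :: "'a::topological_space set" and f :: "'a \<Rightarrow> real \<times> real"
  assumes S: "topological_2_manifold (top_of_set S)"
    and f: "continuous_on S f" "inj_on f S" and "a \<in> S"
  obtains A g where "open A" "f a \<in> A" "continuous_on A g"
    "\<And>b. b \<in> A \<Longrightarrow> g b \<in> S" "\<And>b. b \<in> A \<Longrightarrow> f (g b) = b"
proof -
  obtain V and W :: "(real ^ 2) set" where V: "openin (top_of_set S) V" "a \<in> V" and W: "open W"
    and hom: "subtopology (top_of_set S) V homeomorphic_space top_of_set W"
    using S \<open>a \<in> S\<close> unfolding topological_2_manifold_def by force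
  have VS: "V \<subseteq> S"
    using V openin_imp_subset by blast
  have "top_of_set W homeomorphic_space top_of_set V"
    using hom VS homeomorphic_space_sym
    by (metis subtopology_subtopology inf.absorb2)
  then obtain h k where hk: "homeomorphic_maps (top_of_set W) (top_of_set V) h k"
    unfolding homeomorphic_space_def by blast
  then have h: "continuous_on W h" "h ` W \<subseteq> V"
    and khW: "\<And>w. w \<in> W \<Longrightarrow> k (h w) = w"
    and hkV: "\<And>v. v \<in> V \<Longrightarrow> h (k v) = v" "k ` V \<subseteq> W"
    by (auto simp: homeomorphic_maps_def)
  have cont: "continuous_on W (f \<circ> h)"
    by (meson continuous_on_compose continuous_on_subset f(1) h VS order_trans)
  have inj: "inj_on (f \<circ> h) W"
    using f(2) h(2) VS khW by (smt (verit) comp_apply image_subset_iff inj_on_def subsetD)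
  have A: "open ((f \<circ> h) ` W)"
    using invariance_of_domain_gen [OF W cont inj] by simp
  obtain k' where k': "homeomorphism W ((f \<circ> h) ` W) (f \<circ> h) k'"
    using invariance_of_domain_homeomorphism [OF W cont _ inj] by auto
  show thesis
  proof
    show "open ((f \<circ> h) ` W)" by (fact A)
    show "f a \<in> (f \<circ> h) ` W"
      using V(2) hkV by (metis comp_apply image_eqI image_subset_iff)
    show "continuous_on ((f \<circ> h) ` W) (h \<circ> k')"
      using k' h(1) by (simp only: homeomorphism_def continuous_on_compose)
    show "(h \<circ> k') b \<in> S" if "b \<in> (f \<circ> h) ` W" for b
      using k' h(2) VS that by (auto simp: homeomorphism_def subset_iff image_subset_iff)
    show "f ((h \<circ> k') b) = b" if "b \<in> (f \<circ> h) ` W" for b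
      using k' that by (auto simp: homeomorphism_def)
  qed
qed

lemma open_full_cone: "open (full_cone \<alpha>)"
proof -
  have eq: "full_cone \<alpha> = {p. \<bar>fst (snd p)\<bar> < \<alpha> * \<bar>fst p\<bar>} \<inter> {p. \<bar>snd (snd p)\<bar> < \<alpha> * (fst p)\<^sup>2 / 2}"
    by (auto simp: full_cone_def)
  show ?thesis
    unfolding eq by (intro open_Int open_Collect_less continuous_intros) auto
qed

lemma heis_dilation_full_cone:
  assumes "p \<in> full_cone \<alpha>" "l > 0"
  shows "heis_dilation l p \<in> full_cone \<alpha>"
proof -
  obtain x y z where p: "p = (x, y, z)" by (metis prod_cases3)
  have "\<bar>y\<bar> < \<alpha> * \<bar>x\<bar>" "\<bar>z\<bar> < \<alpha> * x\<^sup>2 / 2"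
    using assms by (auto simp: p full_cone_def)
  then have "l * \<bar>y\<bar> < l * (\<alpha> * \<bar>x\<bar>)" "l\<^sup>2 * \<bar>z\<bar> < l\<^sup>2 * (\<alpha> * x\<^sup>2 / 2)"
    using \<open>l > 0\<close> by simp_all
  with \<open>l > 0\<close> show ?thesis
    by (simp add: p full_cone_def abs_mult power_mult_distrib mult_ac)
qed

lemma heis_cone_full_cone: "heis_cone (full_cone \<alpha>)"
  unfolding heis_cone_def
proof (intro allI impI equalityI subsetI)
  fix l :: real and p assume l: "l > 0"
  { assume "p \<in> heis_dilation l ` full_cone \<alpha>"
    then show "p \<in> full_cone \<alpha>" using heis_dilation_full_cone l by blast }
  assume "p \<in> full_cone \<alpha>"
  then have "heis_dilation (1 / l) p \<in> full_cone \<alpha>" using heis_dilation_full_cone l by simp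
  moreover have "p = heis_dilation l (heis_dilation (1 / l) p)"
    using l by (cases p) (auto simp: power2_eq_square)
  ultimately show "p \<in> heis_dilation l ` full_cone \<alpha>" by blast
qed

lemma heis_inv_mem_full_cone [simp]: "heis_inv p \<in> full_cone \<alpha> \<longleftrightarrow> p \<in> full_cone \<alpha>"
  by (cases p) (simp add: full_cone_def)

lemma heis_inv_full_cone: "heis_inv ` full_cone \<alpha> = full_cone \<alpha>"
  using image_eqI [of _ heis_inv "heis_inv _" "full_cone \<alpha>"] by fastforce

text \<open>The full cone itself is an admissible cone: it is open, invariant under dilations and
  inversion, and contains \<open>(1, 0, 0)\<close>.\<close>

lemma alpha_full_imp_full_cone_property:
  assumes "\<alpha> > 0" "alpha_full_cone_property \<alpha> S"
  shows "full_cone_property S"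
proof -
  have "(1, 0, 0) \<in> full_cone \<alpha> \<inter> {(x, y, z). z = 0}"
    using assms(1) by (simp add: full_cone_def)
  then show ?thesis
    using assms(2) open_full_cone heis_cone_full_cone heis_inv_full_cone
    unfolding full_cone_property_def alpha_full_cone_property_def by blast
qed

text \<open>For \<open>c = (x, y, z)\<close> the common point is sought at first coordinate
  \<open>x / 2\<close>. Vanishing of its third coordinate then forces
  \<open>u = - (y / 2 + 2 * z / x)\<close> and \<open>v = y + u\<close>. The cone with
  \<open>\<alpha> / 4\<close> bounds both by \<open>3 * \<alpha> * x / 8\<close>, below the
  permitted \<open>\<alpha> * x / 2\<close>.\<close>

lemma half_wedges_meet:
  assumes c: "c \<in> full_cone (\<alpha> / 4)" "fst c > 0"
  obtains s u v where "0 < s" "s < fst c" "\<bar>u\<bar> < \<alpha> * s" "\<bar>v\<bar> < \<alpha> * s"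
    "heis_mult c (- s, u, 0) = (s, v, 0)"
proof -
  obtain x y z where cc: "c = (x, y, z)" by (metis prod_cases3)
  have x: "x > 0" and y: "\<bar>y\<bar> < \<alpha> / 4 * x" and z: "\<bar>z\<bar> < \<alpha> / 4 * x\<^sup>2 / 2"
    using c by (auto simp: cc full_cone_def)
  define w where "w = 2 * z / x"
  have "\<bar>w\<bar> < \<alpha> / 4 * x"
    using z x by (simp add: w_def abs_mult power2_eq_square field_simps)
  then have "\<bar>- (y / 2 + w)\<bar> < \<alpha> * (x / 2)" "\<bar>y / 2 - w\<bar> < \<alpha> * (x / 2)"
    using y by linarith+
  moreover have "heis_mult c (- (x / 2), - (y / 2 + w), 0) = (x / 2, y / 2 - w, 0)"
    using x by (simp add: cc w_def field_simps)
  ultimately show thesis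
    using x by (intro that [of "x / 2" "- (y / 2 + w)" "y / 2 - w"]) (auto simp: cc)
qed

text \<open>\<open>fst r - fst (g (xline_proj r))\<close> is the signed distance of \<open>r\<close> from the intrinsic graph
  parametrised by \<open>g\<close>, measured along the \<open>X\<close>-line through \<open>r\<close>.\<close>

lemma wedge_side:
  fixes g :: "real \<times> real \<Rightarrow> heis"
  assumes flat: "avoids_cone S (flat_cone \<alpha>)" and "\<alpha> > 0"
    and g: "continuous_on A g" "\<And>b. b \<in> A \<Longrightarrow> g b \<in> S" "\<And>b. b \<in> A \<Longrightarrow> xline_proj (g b) = b"
    and p: "p \<in> S" and "s \<noteq> 0" and v: "\<bar>v\<bar> < \<alpha> * \<bar>s\<bar>"
    and A: "\<And>t. \<bar>t\<bar> \<le> \<bar>v\<bar> \<Longrightarrow> xline_proj (heis_mult p (s, t, 0)) \<in> A"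
  defines "d \<equiv> \<lambda>r. fst r - fst (g (xline_proj r))"
  shows "0 < s * d (heis_mult p (s, v, 0))"
proof (rule ccontr)
  \<comment> \<open>At fixed \<open>s\<close> this segment crosses the half wedge of
    \<open>p\<close> from the X-line through \<open>p\<close> to the point in question. The factor
    \<open>s\<close> treats both halves at once: \<open>s * d\<close> starts at the square of
    \<open>s\<close>, so failure of the claim produces a zero.\<close>
  let ?\<gamma> = "\<lambda>t. heis_mult p (s, t * v, 0)"
  assume neg: "\<not> 0 < s * d (heis_mult p (s, v, 0))"
  have in_A: "xline_proj (?\<gamma> t) \<in> A" if "t \<in> {0..1}" for t
    using that by (intro A) (auto simp: abs_mult mult_left_le_one_le)
  have "continuous_on {0..1} (\<lambda>t. xline_proj (?\<gamma> t))"
    by (auto simp: xline_proj_alt heis_mult_alt intro!: continuous_intros)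
  then have "continuous_on {0..1} (\<lambda>t. g (xline_proj (?\<gamma> t)))"
    using in_A by (intro continuous_on_compose2 [OF g(1)]) auto
  then have cont: "continuous_on {0..1} (\<lambda>t. s * d (?\<gamma> t))"
    unfolding d_def by (auto simp: heis_mult_alt intro!: continuous_intros)
  have pA: "xline_proj p \<in> A"
    using A [of 0] by (simp add: xline_proj_mult_X)
  then have "g (xline_proj p) = p"
    using inj_onD [OF avoids_flat_cone_inj_on [OF flat \<open>\<alpha> > 0\<close>]] g(2,3) p by blast
  then have "d (?\<gamma> 0) = s"
    by (simp add: d_def xline_proj_mult_X) (simp add: heis_mult_alt)
  then have "0 \<le> s * d (?\<gamma> 0)" by simp
  then obtain t where t: "0 \<le> t" "t \<le> 1" "s * d (?\<gamma> t) = 0"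
    using neg IVT2' [of "\<lambda>t. s * d (?\<gamma> t)" 1 0 0] cont by (auto simp: not_less)
  \<comment> \<open>At a zero of \<open>d\<close> the path point and the graph point on its X-line
    share first coordinate and projection. Hence they coincide, and the path meets \<open>S\<close>
    inside the translated flat cone.\<close>
  then have "fst (g (xline_proj (?\<gamma> t))) = fst (?\<gamma> t)" using \<open>s \<noteq> 0\<close> by (simp add: d_def)
  moreover have "xline_proj (g (xline_proj (?\<gamma> t))) = xline_proj (?\<gamma> t)"
    using in_A t g(3) by simp
  ultimately have "g (xline_proj (?\<gamma> t)) = ?\<gamma> t"
    by (simp only: xline_proj_alt) (auto simp: prod_eq_iff)
  then have "?\<gamma> t \<in> S"
    using in_A [of t] t g(2) by fastforce
  moreover have "(s, t * v, 0) \<in> flat_cone \<alpha>"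
    using v t mult_left_le_one_le [of "\<bar>v\<bar>" t] by (simp add: flat_cone_def abs_mult)
  ultimately show False
    using avoids_coneD [OF flat p] by blast
qed

lemma flat_cone_imp_locally_full_cone:
  assumes surf: "topological_surface S" and "\<alpha> > 0" and flat: "alpha_flat_cone_property \<alpha> S"
  shows "has_locally (alpha_full_cone_property (\<alpha> / 4)) S"
  unfolding has_locally_def
proof
  fix a assume "a \<in> S"
  have fl: "avoids_cone S (flat_cone \<alpha>)"
    using flat by (simp add: alpha_flat_cone_property_def)
  have "continuous_on S xline_proj"
    by (auto simp: xline_proj_alt [abs_def] intro!: continuous_intros)
  then obtain A g where "open A" "xline_proj a \<in> A" and g: "continuous_on A g"
    "\<And>b. b \<in> A \<Longrightarrow> g b \<in> S" "\<And>b. b \<in> A \<Longrightarrow> xline_proj (g b) = b"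
    using topological_2_manifold_local_section [OF _ _ avoids_flat_cone_inj_on [OF fl \<open>\<alpha> > 0\<close>] \<open>a \<in> S\<close>]
      surf unfolding topological_surface_def by metis
  \<comment> \<open>Continuity of \<open>F\<close> at \<open>(a, 0, 0)\<close> lets all short wedge
    segments from points near \<open>a\<close> project into \<open>A\<close>, where the graph is
    defined.\<close>
  define F where "F = (\<lambda>(p, s, t). xline_proj (heis_mult p (s, t, 0)))"
  have "continuous_on UNIV F"
    unfolding F_def case_prod_unfold xline_proj_alt heis_mult_alt
    by (auto intro!: continuous_intros)
  then have "open (F -` A)"
    using \<open>open A\<close> by (simp add: continuous_on_open_vimage)
  moreover have "(a, 0, 0) \<in> F -` A"
    using \<open>xline_proj a \<in> A\<close> by (simp add: F_def xline_proj_mult_X)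
  ultimately obtain U I where UI: "open U" "open I" "(a, 0, 0) \<in> U \<times> I" "U \<times> I \<subseteq> F -` A"
    by (metis open_prod_elim)
  then obtain J K where JK: "open J" "open K" "(0, 0) \<in> J \<times> K" "J \<times> K \<subseteq> I"
    by (metis open_prod_elim SigmaD2)
  then obtain e where e: "e > 0" "ball 0 e \<subseteq> J \<inter> K"
    using openE [of "J \<inter> K" 0] by blast
  have in_A: "xline_proj (heis_mult p (s, t, 0)) \<in> A" if "p \<in> U" "\<bar>s\<bar> < e" "\<bar>t\<bar> < e" for p s t
  proof -
    have "s \<in> J" "t \<in> K" using that e(2) by (auto simp: subset_iff)
    then have "(p, s, t) \<in> F -` A" using UI JK that by blast
    then show ?thesis by (simp add: F_def)
  qed
  \<comment> \<open>For \<open>s < r\<close> both \<open>s\<close> and \<open>\<alpha> * s\<close>,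
    the bound on \<open>u\<close> and \<open>v\<close>, stay below \<open>e\<close>.\<close>
  define r where "r = min e (e / \<alpha>)"
  have r: "r > 0" "r \<le> e" "\<alpha> * r \<le> e"
    using e \<open>\<alpha> > 0\<close> by (auto simp: r_def min_def field_simps)
  \<comment> \<open>Half the radius makes any two points of \<open>U'\<close> closer than
    \<open>r\<close>, so their first coordinates differ by less than \<open>r\<close>.\<close>
  define U' where "U' = U \<inter> ball a (r / 2)"
  have no_pair: False
    if "p \<in> S \<inter> U'" "q \<in> S \<inter> U'" and c: "heis_mult (heis_inv p) q \<in> full_cone (\<alpha> / 4)"
      and pos: "fst (heis_mult (heis_inv p) q) > 0" for p q
  proof -
    define c where "c = heis_mult (heis_inv p) q"
    have pq: "p \<in> S" "q \<in> S" "p \<in> U" "q \<in> U" using that by (auto simp: U'_def)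
    have "dist q p < r"
      using that dist_triangle_half_r [of a p r q] by (auto simp: U'_def dist_commute)
    moreover have "fst c = fst q - fst p" by (cases p; cases q) (simp add: c_def)
    ultimately have "fst c < r"
      using dist_fst_le [of q p] by (simp add: dist_real_def)
    obtain s u v where s: "0 < s" "s < fst c" and u: "\<bar>u\<bar> < \<alpha> * s" and v: "\<bar>v\<bar> < \<alpha> * s"
      and m: "heis_mult c (- s, u, 0) = (s, v, 0)"
      using half_wedges_meet [of c \<alpha>] c pos by (auto simp: c_def)
    have "s < r" using s \<open>fst c < r\<close> by simp
    then have "\<alpha> * s < \<alpha> * r" using \<open>\<alpha> > 0\<close> by simp
    then have bd: "s < e" "\<bar>u\<bar> < e" "\<bar>v\<bar> < e" using u v \<open>s < r\<close> r by auto
    \<comment> \<open>Since \<open>q\<close> is \<open>p\<close> times \<open>c\<close>, one point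
      lies in the right half wedge of \<open>p\<close> and in the left half wedge of
      \<open>q\<close>; its signed distance from the graph would be both positive and
      negative.\<close>
    have "heis_mult q (- s, u, 0) = heis_mult p (heis_mult c (- s, u, 0))"
      by (simp add: c_def heis_mult_assoc [symmetric] heis_mult_inv_right del: heis_mult.simps)
         (simp add: heis_mult_assoc heis_mult_inv_right)
    then have eq: "heis_mult q (- s, u, 0) = heis_mult p (s, v, 0)" by (simp only: m)
    have "0 < s * (fst (heis_mult p (s, v, 0)) - fst (g (xline_proj (heis_mult p (s, v, 0)))))"
      using s v bd pq by (intro wedge_side [OF fl \<open>\<alpha> > 0\<close> g] in_A) auto
    moreover have "0 < - s * (fst (heis_mult q (- s, u, 0))
        - fst (g (xline_proj (heis_mult q (- s, u, 0)))))"
      using s u bd pq by (intro wedge_side [OF fl \<open>\<alpha> > 0\<close> g] in_A) auto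
    ultimately show False
      using eq by simp
  qed
  have "alpha_full_cone_property (\<alpha> / 4) (S \<inter> U')"
    unfolding alpha_full_cone_property_def avoids_cone_iff
  proof (intro ballI notI)
    fix p q assume pq: "p \<in> S \<inter> U'" "q \<in> S \<inter> U'"
      and c: "heis_mult (heis_inv p) q \<in> full_cone (\<alpha> / 4)"
    \<comment> \<open>Inversion preserves the full cone and flips the first coordinate, so
      exchanging \<open>p\<close> and \<open>q\<close> if necessary makes that coordinate
      positive.\<close>
    have inv: "heis_mult (heis_inv q) p = heis_inv (heis_mult (heis_inv p) q)"
      by (simp add: heis_inv_mult)
    have "fst (heis_mult (heis_inv p) q) \<noteq> 0"
      using c by (auto simp: full_cone_def)
    moreover have "fst (heis_mult (heis_inv q) p) = - fst (heis_mult (heis_inv p) q)"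
      by (cases p; cases q) simp
    ultimately consider "fst (heis_mult (heis_inv p) q) > 0" | "fst (heis_mult (heis_inv q) p) > 0"
      by linarith
    then show False
      using no_pair [OF pq c] no_pair [OF pq(2,1)] c inv by cases auto
  qed
  moreover have "open U'" "a \<in> U'"
    using UI r by (auto simp: U'_def)
  ultimately show "\<exists>U. open U \<and> a \<in> U \<and> alpha_full_cone_property (\<alpha> / 4) (S \<inter> U)"
    by blast
qed

theorem mainTheorem1:
  fixes S :: "heis set"
  assumes "topological_surface S"
  shows "(flat_cone_property S \<longrightarrow> has_locally full_cone_property S) \<and>
         (\<forall>\<alpha>>0. alpha_flat_cone_property \<alpha> S \<longrightarrow>
            has_locally (alpha_full_cone_property (\<alpha> / 4)) S)"
proof (intro conjI impI allI)
  assume "flat_cone_property S"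
  then obtain \<alpha> where "\<alpha> > 0" "has_locally (alpha_full_cone_property (\<alpha> / 4)) S"
    using flat_cone_imp_locally_full_cone [OF assms] by (auto simp: flat_cone_property_def)
  then show "has_locally full_cone_property S"
    using alpha_full_imp_full_cone_property [of "\<alpha> / 4"] unfolding has_locally_def
    by (meson zero_less_divide_iff zero_less_numeral)
qed (rule flat_cone_imp_locally_full_cone [OF assms])

end
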